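(* Let $q$ be a prime power and let $\ell',t>1$ be integers with $n=\ell't$. Let $\mu\in\mathbb{F}_{q^n}^*$ with $\mathbb{F}_q(\mu)=\mathbb{F}_{q^t}$. Let $\overline{S}$ be an $\mathbb{F}_{q^t}$-subspace of $\mathbb{F}_{q^n}$ of dimension $\ell$ over $\mathbb{F}_{q^t}$, where $1\le\ell<\ell'$, and let $b\in\mathbb{F}_{q^n}^*$ with $\overline{S}\cap b\mathbb{F}_{q^t}=\{0\}$. Let $m,j>0$ be integers with $m+j\le t+1$. Let $S=\overline{S}\oplus b\langle 1,\mu,\ldots,\mu^{m-1}\rangle_{\mathbb{F}_q}$, $T=\langle 1,\mu,\ldots,\mu^{j-1}\rangle_{\mathbb{F}_q}$ and $U=S\times T$. - If $j\le m$, then there exists a linear set of Jena–Van de Voorde type in $\mathrm{PG}(1,q^n)$ with the same weight spectrum and the same weight distribution as $L_U$. - If $j>m$, then there exists a linear set of Jena–Van de Voorde type in $\mathrm{PG}(1,q^n)$ with the same weight spectrum and the same weight distribution as $L_U$ if and only if $j=m+1$.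
   Context: For an $\mathbb{F}_q$-subspace $U\neq\{0\}$ of $\mathbb{F}_{q^n}^2$, the $\mathbb{F}_q$-linear set $L_U=\{\langle u\rangle_{\mathbb{F}_{q^n}}: u\in U\setminus\{0\}\}\subseteq\mathrm{PG}(1,q^n)$ has rank $\dim_{\mathbb{F}_q}U$; the weight of a point $P=\langle v\rangle_{\mathbb{F}_{q^n}}$ in $L_U$ is $w_{L_U}(P)=\dim_{\mathbb{F}_q}(U\cap\langle v\rangle_{\mathbb{F}_{q^n}})$. The weight spectrum of $L_U$ is the set of integers occurring as weights of points of $L_U$, and the weight distribution gives, for each such integer $i$, the number $N_i$ of points of $L_U$ of weight $i$. For $S,T\subseteq\mathbb{F}_{q^n}$, $S\times T=\{(s,t):s\in S,t\in T\}$. A linear set of Jena–Van de Voorde type is a linear set $L_W$ with $W=\langle 1,\lambda,\ldots,\lambda^{t_1-1}\rangle_{\mathbb{F}_q}\times\langle 1,\lambda,\ldots,\lambda^{t_2-1}\rangle_{\mathbb{F}_q}$, where $\lambda\in\mathbb{F}_{q^n}\setminus\mathbb{F}_q$ generates the subfield $\mathbb{F}_{q^s}=\mathbb{F}_q(\lambda)$ and $t_1,t_2\ge1$ are integers with $t_1+t_2\le s+1$. *)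

theory Defs
  imports Complex_Main "HOL-Library.Product_Plus" "HOL-Library.Cardinality"
    "HOL-Number_Theory.Prime_Powers"
begin

text \<open>
  A field extension is a homomorphism between field types. This makes a field the scalar type
  of its extensions, so that span, subspace and dim are those of the locales
  \<^locale>\<open>module\<close> and \<^locale>\<open>vector_space\<close>.
\<close>

definition field_embedding :: "('k::field \<Rightarrow> 'e::field) \<Rightarrow> bool" where
  "field_embedding emb \<longleftrightarrow>
     emb 1 = 1 \<and> (\<forall>x y. emb (x + y) = emb x + emb y) \<and> (\<forall>x y. emb (x * y) = emb x * emb y)"

definition escale :: "('k::field \<Rightarrow> 'e::field) \<Rightarrow> 'k \<Rightarrow> 'e \<Rightarrow> 'e" where
  "escale emb c x = emb c * x"

definition escale2 :: "('k::field \<Rightarrow> 'e::field) \<Rightarrow> 'k \<Rightarrow> 'e \<times> 'e \<Rightarrow> 'e \<times> 'e" where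
  "escale2 emb c v = (emb c * fst v, emb c * snd v)"

lemma vector_space_escale: "field_embedding emb \<Longrightarrow> vector_space (escale emb)"
  by unfold_locales (auto simp: field_embedding_def escale_def algebra_simps)

lemma vector_space_escale2: "field_embedding emb \<Longrightarrow> vector_space (escale2 emb)"
  by unfold_locales
    (auto simp: field_embedding_def escale2_def algebra_simps plus_prod_def)

definition is_subfield :: "'e::field set \<Rightarrow> bool" where
  "is_subfield K \<longleftrightarrow> 0 \<in> K \<and> 1 \<in> K \<and>
     (\<forall>x\<in>K. \<forall>y\<in>K. x - y \<in> K \<and> x * y \<in> K) \<and> (\<forall>x\<in>K. inverse x \<in> K)"

text \<open>The simple extension obtained by adjoining \<open>a\<close> to the image of \<open>emb\<close>.\<close>

definition adjoin :: "('k::field \<Rightarrow> 'e::field) \<Rightarrow> 'e \<Rightarrow> 'e set" where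
  "adjoin emb a = \<Inter>{K. is_subfield K \<and> range emb \<subseteq> K \<and> a \<in> K}"

text \<open>The span of \<open>1, a, \<dots>, a ^ (k - 1)\<close>.\<close>

definition power_span :: "('k::field \<Rightarrow> 'e::field) \<Rightarrow> 'e \<Rightarrow> nat \<Rightarrow> 'e set" where
  "power_span emb a k = module.span (escale emb) ((\<lambda>i. a ^ i) ` {..<k})"

text \<open>
  Points of the projective line over \<open>'e\<close> are the one-dimensional \<open>'e\<close>-subspaces of
  \<open>'e \<times> 'e\<close>. Weights depend on \<open>U\<close> and on the scalar field, not only on the
  set of points, hence \<open>U\<close> and \<open>emb\<close> are arguments of the notions below.
\<close>

definition pg_point :: "'e::field \<times> 'e \<Rightarrow> ('e \<times> 'e) set" where
  "pg_point v = module.span (escale2 (\<lambda>c. c)) {v}"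

definition linear_set :: "('e::field \<times> 'e) set \<Rightarrow> ('e \<times> 'e) set set" where
  "linear_set U = pg_point ` (U - {0})"

definition weight ::
  "('k::field \<Rightarrow> 'e::field) \<Rightarrow> ('e \<times> 'e) set \<Rightarrow> ('e \<times> 'e) set \<Rightarrow> nat" where
  "weight emb U P = vector_space.dim (escale2 emb) (U \<inter> P)"

definition weight_spectrum :: "('k::field \<Rightarrow> 'e::field) \<Rightarrow> ('e \<times> 'e) set \<Rightarrow> nat set" where
  "weight_spectrum emb U = weight emb U ` linear_set U"

definition weight_distribution ::
  "('k::field \<Rightarrow> 'e::field) \<Rightarrow> ('e \<times> 'e) set \<Rightarrow> (nat \<times> nat) set" where
  "weight_distribution emb U =
     {(i, card {P \<in> linear_set U. weight emb U P = i}) | i. i \<in> weight_spectrum emb U}"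

text \<open>
  \<open>is_JVdV emb W\<close>: the linear set defined by \<open>W\<close> is of Jena--Van de Voorde type. The integer
  \<open>s\<close> is determined by \<open>a\<close>: the field generated by \<open>a\<close> has \<open>q ^ s\<close> elements, where \<open>q\<close> is the
  order of the scalar field.
\<close>

definition is_JVdV :: "('k::{field,finite} \<Rightarrow> 'e::{field,finite}) \<Rightarrow> ('e \<times> 'e) set \<Rightarrow> bool" where
  "is_JVdV emb W \<longleftrightarrow>
     (\<exists>a s t1 t2. a \<notin> range emb \<and> card (adjoin emb a) = CARD('k) ^ s \<and>
        1 \<le> t1 \<and> 1 \<le> t2 \<and> t1 + t2 \<le> s + 1 \<and>
        W = power_span emb a t1 \<times> power_span emb a t2)"

end

theory Submission
  imports Defs "HOL-Algebra.Algebraic_Closure_Type"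
begin

text \<open>
  The weight of the point \<open>\<langle>(x, 1)\<rangle>\<close> is the dimension of \<open>{y \<in> T. x * y \<in> S}\<close>. For the power spans
  \<open>P t1 \<times> P t2\<close> of an element of degree \<open>s \<ge> t1 + t2 - 1\<close>, lowering \<open>t1\<close> and \<open>t2\<close> by one lowers
  every positive weight by exactly one; comparing the counts of nonzero vectors for the two pairs
  then gives \<open>q ^ (t1 + t2 + 1 - 2 * i)\<close> affine points of weight at least \<open>i\<close>, for
  \<open>1 \<le> i \<le> min t1 t2\<close>. In \<open>U\<close>, the point over \<open>x + b * z\<close> has the weight of the point over \<open>z\<close>
  in \<open>P m \<times> P j\<close>, so all these counts are multiplied by \<open>q ^ (t * l)\<close>. If \<open>j \<le> m + 1\<close>, this
  agrees with the power spans of dimensions \<open>t * l + m\<close> and \<open>j\<close> for a primitive element of the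
  whole field. If \<open>j > m + 1\<close>, then \<open>j\<close> and \<open>t * l + m\<close> are weights of \<open>U\<close> but \<open>m + 1\<close> is not,
  whereas a Jena--Van de Voorde spectrum has at most one element above its initial segment.
\<close>

section \<open>Cardinalities of subspaces over a finite field\<close>

text \<open>The condition \<open>mod\<close> says that \<open>V'\<close> and the line through
  \<open>v\<close> generate \<open>V\<close>, and \<open>v \<notin> V'\<close> makes the sum direct.
  Codimension one thus becomes a statement about cardinalities, without any choice of bases.\<close>

lemma card_subspace_step:
  fixes scale :: "'a::{field,finite} \<Rightarrow> 'b::ab_group_add \<Rightarrow> 'b"
  assumes "vector_space scale" "module.subspace scale V" "module.subspace scale V'" "V' \<subseteq> V"
    and "v \<in> V" "v \<notin> V'" and mod: "\<And>x. x \<in> V \<Longrightarrow> \<exists>c. x - scale c v \<in> V'"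
  shows "card V = CARD('a) * card V'"
proof -
  interpret vector_space scale by fact
  have "bij_betw (\<lambda>(c, x). scale c v + x) (UNIV \<times> V') V"
    unfolding bij_betw_def
  proof
    show "inj_on (\<lambda>(c, x). scale c v + x) (UNIV \<times> V')"
    proof (rule inj_onI, clarify)
      fix c d x y assume xy: "x \<in> V'" "y \<in> V'" and eq: "scale c v + x = scale d v + y"
      have "scale (c - d) v = y - x"
        using eq by (simp add: scale_left_diff_distrib algebra_simps)
      then have "scale (c - d) v \<in> V'"
        using xy assms(3) subspace_diff by auto
      have "c = d"
      proof (rule ccontr)
        assume "c \<noteq> d"
        then have "v = scale (inverse (c - d)) (scale (c - d) v)" by simp
        then show False
          using \<open>scale (c - d) v \<in> V'\<close> \<open>v \<notin> V'\<close> assms(3) subspace_scale by metis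
      qed
      then show "c = d \<and> x = y" using eq by simp
    qed
    show "(\<lambda>(c, x). scale c v + x) ` (UNIV \<times> V') = V"
    proof (intro equalityI subsetI)
      fix x assume "x \<in> V"
      then obtain c where "x - scale c v \<in> V'" using mod by blast
      then show "x \<in> (\<lambda>(c, x). scale c v + x) ` (UNIV \<times> V')"
        by (intro image_eqI[of _ _ "(c, x - scale c v)"]) auto
    qed (use assms in \<open>auto intro!: subspace_add subspace_scale\<close>)
  qed
  then show ?thesis
    by (metis bij_betw_same_card card_cartesian_product)
qed

text \<open>Adjoining an independent vector multiplies the span by the order of the scalar field.
  Later dimension arguments are all carried out by counting vectors.\<close>

lemma card_finite_subspace:
  fixes scale :: "'a::{field,finite} \<Rightarrow> 'b::ab_group_add \<Rightarrow> 'b"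
  assumes "vector_space scale" "module.subspace scale V" "finite V"
  shows "card V = CARD('a) ^ vector_space.dim scale V"
proof -
  interpret vector_space scale by fact
  have card_span: "card (span B) = CARD('a) ^ card B" if "finite B" "independent B" for B
    using that
  proof induction
    case (insert v B)
    have "card (span (insert v B)) = CARD('a) * card (span B)"
    proof (rule card_subspace_step[OF assms(1)])
      show "v \<notin> span B"
        using insert.prems insert.hyps independent_insert by auto
      show "\<exists>c. x - scale c v \<in> span B" if "x \<in> span (insert v B)" for x
        using that by (simp add: span_breakdown_eq)
      show "span B \<subseteq> span (insert v B)"
        by (rule span_mono) auto
    qed (auto intro: span_base)
    then show ?case
      using insert independent_mono[of "insert v B" B] by auto
  qed simp
  obtain B where B: "B \<subseteq> V" "independent B" "V \<subseteq> span B" "card B = dim V"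
    by (rule basis_exists)
  then have "span B = V"
    using assms(2) span_minimal by blast
  then show ?thesis
    using card_span[of B] B finite_subset[OF B(1) assms(3)] by simp
qed

lemma CARD_field_ge_2: "CARD('a::{field,finite}) \<ge> 2"
  using card_mono[of UNIV "{0, 1::'a}"] by simp

section \<open>Simple extensions of finite fields\<close>

text \<open>The multiplicative group of a finite field is cyclic; the type is viewed as a field with
  explicit carrier to apply this. A generator later serves as an element whose adjunction gives the
  whole field.\<close>

lemma finite_field_primitive_element:
  "\<exists>a::'a::{field,finite}. \<forall>x. x \<noteq> 0 \<longrightarrow> (\<exists>i::nat. x = a ^ i)"
proof -
  define R where "R = (ring_of_type_algebra :: 'a ring)"
  interpret R: field R unfolding R_def by (rule field_from_type_algebra)
  have R: "carrier R = UNIV" "mult R = (*)" "\<one>\<^bsub>R\<^esub> = 1" "\<zero>\<^bsub>R\<^esub> = 0"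
    by (auto simp: R_def ring_of_type_algebra_def)
  have pow: "a [^]\<^bsub>R\<^esub> i = a ^ i" for a and i :: nat
    by (induction i) (auto simp: R mult.commute)
  obtain a where "carrier (mult_of R) = {a [^]\<^bsub>R\<^esub> i | i::nat. i \<in> UNIV}"
    using R.finite_field_mult_group_has_gen by (auto simp: R)
  then have "UNIV - {0} = {a ^ i | i::nat. i \<in> UNIV}"
    by (simp add: R pow)
  then show ?thesis
    by blast
qed

section \<open>Arithmetic of an embedding of finite fields\<close>

locale finite_extension =
  fixes emb :: "'k::{field,finite} \<Rightarrow> 'e::{field,finite}"
  assumes emb: "field_embedding emb"
begin

sublocale vs: vector_space "escale emb"
  by (rule vector_space_escale[OF emb])

sublocale vs2: vector_space "escale2 emb"
  by (rule vector_space_escale2[OF emb])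

lemma q_ge_2: "CARD('k) \<ge> 2" by (rule CARD_field_ge_2)

lemma emb_simps [simp]: "emb 0 = 0" "emb 1 = 1" "emb (x + y) = emb x + emb y"
  "emb (x * y) = emb x * emb y" "emb (- x) = - emb x" "emb (x - y) = emb x - emb y"
proof -
  show *: "emb 1 = 1" "emb (x * y) = emb x * emb y" and add: "emb (x + y) = emb x + emb y" for x y
    using emb by (auto simp: field_embedding_def)
  show 0: "emb 0 = 0" using add[of 0 0] by (metis add_0 add_cancel_right_right)
  show neg: "emb (- x) = - emb x" for x
    using add[of x "- x"] 0 by (simp add: eq_neg_iff_add_eq_0 add.commute)
  show "emb (x - y) = emb x - emb y"
    using add[of x "- y"] by (simp add: neg)
qed

lemma emb_inverse [simp]: "emb (inverse x) = inverse (emb x)"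
proof (cases "x = 0")
  case False
  then have "emb (inverse x) * emb x = 1"
    using emb_simps(4)[of "inverse x" x] by (simp del: emb_simps(4))
  then show ?thesis by (metis inverse_unique mult.commute)
qed simp

lemma emb_eq_0_iff [simp]: "emb x = 0 \<longleftrightarrow> x = 0"
proof
  assume "emb x = 0"
  then have "emb (x * inverse x) = 0" by (simp del: right_inverse)
  then show "x = 0" by (cases "x = 0") auto
qed simp

lemma inj_emb: "inj emb"
  by (rule injI) (metis emb_eq_0_iff emb_simps(6) right_minus_eq)

lemma range_subfield: "is_subfield (range emb)"
  unfolding is_subfield_def
proof (intro conjI ballI)
  show "0 \<in> range emb" "1 \<in> range emb" by (metis emb_simps(1,2) rangeI)+
  fix x y assume "x \<in> range emb" "y \<in> range emb"
  then obtain u v where uv: "x = emb u" "y = emb v" by blast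
  show "x - y \<in> range emb" "x * y \<in> range emb"
    using uv by (auto simp only: simp_thms emb_simps(4,6)[symmetric])
next
  fix x assume "x \<in> range emb"
  then obtain u where "x = emb u" by blast
  then show "inverse x \<in> range emb" by (auto simp only: simp_thms emb_inverse[symmetric])
qed

lemma subspace_iff: "vs.subspace V \<longleftrightarrow> 0 \<in> V \<and> (\<forall>x\<in>V. \<forall>y\<in>V. x + y \<in> V) \<and> (\<forall>c. \<forall>x\<in>V. emb c * x \<in> V)"
  by (auto simp: vs.subspace_def escale_def)

lemma subfield_adjoin: "is_subfield (adjoin emb a)"
  unfolding adjoin_def is_subfield_def by blast

lemma range_subset_adjoin: "range emb \<subseteq> adjoin emb a"
  unfolding adjoin_def by blast

lemma generator_in_adjoin: "a \<in> adjoin emb a"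
  unfolding adjoin_def by blast

lemma subfield_power: "is_subfield K \<Longrightarrow> x \<in> K \<Longrightarrow> x ^ i \<in> K"
  by (induction i) (auto simp: is_subfield_def)

lemma subspace_subfield: "is_subfield K \<Longrightarrow> range emb \<subseteq> K \<Longrightarrow> vs.subspace K"
  unfolding subspace_iff
proof (intro conjI ballI allI)
  fix x y assume K: "is_subfield K" and xy: "x \<in> K" "y \<in> K"
  then have "0 - y \<in> K" unfolding is_subfield_def by blast
  then have "x - (0 - y) \<in> K" using K xy unfolding is_subfield_def by blast
  then show "x + y \<in> K" by simp
qed (auto simp: is_subfield_def)

section \<open>Power spans as polynomials of bounded degree in one element\<close>

lemma power_span_subset_adjoin: "power_span emb a k \<subseteq> adjoin emb a"
  unfolding power_span_def
  by (rule vs.span_minimal)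
    (auto intro!: subfield_power subfield_adjoin generator_in_adjoin subspace_subfield range_subset_adjoin)

lemma subspace_power_span: "vs.subspace (power_span emb a k)"
  by (simp add: power_span_def)

lemma power_span_0 [simp]: "power_span emb a 0 = {0}"
  by (simp add: power_span_def)

lemma power_in_power_span: "i < k \<Longrightarrow> a ^ i \<in> power_span emb a k"
  unfolding power_span_def by (rule vs.span_base) auto

lemma power_span_mono: "i \<le> k \<Longrightarrow> power_span emb a i \<subseteq> power_span emb a k"
  unfolding power_span_def by (rule vs.span_mono) auto

lemma power_span_Suc_iff:
  "x \<in> power_span emb a (Suc k) \<longleftrightarrow> (\<exists>c. x - emb c * a ^ k \<in> power_span emb a k)"
  by (simp add: power_span_def lessThan_Suc vs.span_breakdown_eq escale_def)

text \<open>Degrees below \<open>i\<close> and below \<open>k\<close> add up to a degree below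
  \<open>i + k - 1\<close>. If \<open>i\<close> or \<open>k\<close> is 0, the product is 0, so the
  truncated subtraction does no harm.\<close>

lemma mult_power_span:
  assumes "x \<in> power_span emb a i" "y \<in> power_span emb a k"
  shows "x * y \<in> power_span emb a (i + k - 1)"
proof -
  have *: "a ^ r * y \<in> power_span emb a (i + k - 1)" if "r < i" for r
    using assms(2) unfolding power_span_def[of _ _ k]
  proof (induction rule: vs.span_induct_alt)
    case (step c z w)
    then obtain s where s: "z = a ^ s" "s < k" by auto
    have "a ^ (r + s) \<in> power_span emb a (i + k - 1)"
      using s that by (intro power_in_power_span) auto
    then have "emb c * a ^ (r + s) + a ^ r * w \<in> power_span emb a (i + k - 1)"
      using step.IH subspace_power_span unfolding subspace_iff by blast
    then show ?case by (simp add: s escale_def algebra_simps power_add)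
  qed (use subspace_power_span subspace_iff in auto)
  show ?thesis
    using assms(1) unfolding power_span_def[of _ _ i]
  proof (induction rule: vs.span_induct_alt)
    case (step c z w)
    then obtain r where r: "z = a ^ r" "r < i" by auto
    have "emb c * (a ^ r * y) + w * y \<in> power_span emb a (i + k - 1)"
      using step.IH *[OF r(2)] subspace_power_span unfolding subspace_iff by blast
    then show ?case by (simp add: r escale_def algebra_simps)
  qed (use subspace_power_span subspace_iff in auto)
qed

lemma mult_generator_power_span:
  assumes "x \<in> power_span emb a k" shows "a * x \<in> power_span emb a (Suc k)"
  using mult_power_span[OF power_in_power_span[of 1 2 a] assms] by simp

lemma card_power_span_le: "card (power_span emb a k) \<le> CARD('k) ^ k"
proof -
  have "card (power_span emb a k) = CARD('k) ^ vs.dim (power_span emb a k)"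
    by (rule card_finite_subspace[OF vs.vector_space_axioms subspace_power_span]) simp
  moreover have "vs.dim (power_span emb a k) \<le> card ((\<lambda>i. a ^ i) ` {..<k})"
    unfolding power_span_def by (rule vs.dim_le_card) auto
  then have "vs.dim (power_span emb a k) \<le> k"
    using card_image_le[of "{..<k}" "\<lambda>i. a ^ i"] by simp
  ultimately show ?thesis
    using q_ge_2 by (simp add: power_increasing)
qed

text \<open>If \<open>a ^ k\<close> were a combination of lower powers, the power span would be
  closed under multiplication by \<open>a\<close> and hence be a subfield containing
  \<open>a\<close>. It has at most \<open>CARD('k) ^ k\<close> elements, too few to contain
  \<open>adjoin emb a\<close>.\<close>

lemma power_notin_power_span:
  assumes "card (adjoin emb a) = CARD('k) ^ s" "k < s"
  shows "a ^ k \<notin> power_span emb a k"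
proof
  let ?P = "power_span emb a k"
  assume ak: "a ^ k \<in> ?P"
  have sub: "vs.subspace ?P" by (rule subspace_power_span)
  then have add: "x + y \<in> ?P" and scale: "emb c * x \<in> ?P" if "x \<in> ?P" "y \<in> ?P" for x y c
    using that unfolding subspace_iff by auto
  \<comment> \<open>The only power in \<open>a * x\<close> that could leave the span is
    \<open>a ^ k\<close>, which lies in it by \<open>ak\<close>.\<close>
  have closed: "a * x \<in> ?P" if x: "x \<in> ?P" for x
  proof -
    obtain c where c: "a * x - emb c * a ^ k \<in> ?P"
      using mult_generator_power_span[OF x] by (auto simp: power_span_Suc_iff)
    then show ?thesis using add[OF c scale[OF ak ak, of c]] by simp
  qed
  then have pow: "a ^ i * x \<in> ?P" if "x \<in> ?P" for x i
    using that by (induction i) (auto simp: mult.assoc)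
  have mult: "x * y \<in> ?P" if "x \<in> ?P" "y \<in> ?P" for x y
    using that(1)[unfolded power_span_def]
  proof (induction rule: vs.span_induct_alt)
    case (step c z w)
    then obtain r where r: "z = a ^ r" by auto
    have "a ^ r * y \<in> ?P" by (rule pow[OF that(2)])
    from scale[OF this this] have "emb c * (a ^ r * y) + w * y \<in> ?P"
      using step.IH by (rule add)
    then show ?case by (simp add: r escale_def algebra_simps)
  qed (use vs.subspace_0[OF sub] in simp)
  have "k \<noteq> 0" using ak by (intro notI) simp
  then have one: "1 \<in> ?P" using power_in_power_span[of 0 k a] by simp
  have inv: "inverse x \<in> ?P" if "x \<in> ?P" for x
  proof (cases "x = 0")
    case False
    \<comment> \<open>Multiplication by \<open>x\<close> is an injective self-map of a finite set,
      hence onto, so it attains 1.\<close>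
    have "(*) x ` ?P = ?P"
      using mult that False by (intro card_subset_eq) (auto simp: card_image inj_on_def)
    then obtain y where "y \<in> ?P" "x * y = 1" using one by (metis imageE)
    then show ?thesis using inverse_unique[of x y] by simp
  qed (use that in simp)
  have "is_subfield ?P"
    unfolding is_subfield_def
    by (intro conjI ballI one inv mult vs.subspace_diff[OF sub] vs.subspace_0[OF sub])
  moreover have "range emb \<subseteq> ?P"
  proof
    fix x assume "x \<in> range emb"
    then obtain c where "x = emb c * 1" by auto
    then show "x \<in> ?P" using scale[OF one one] by simp
  qed
  moreover have "a \<in> ?P" using closed[OF one] by simp
  ultimately have "adjoin emb a \<subseteq> ?P"
    unfolding adjoin_def by blast
  then have "CARD('k) ^ s \<le> card ?P"
    using assms(1) card_mono[of ?P "adjoin emb a"] by simp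
  also have "\<dots> \<le> CARD('k) ^ k" by (rule card_power_span_le)
  also have "\<dots> < CARD('k) ^ s" using assms(2) q_ge_2 by simp
  finally show False by simp
qed

lemma card_power_span:
  assumes "card (adjoin emb a) = CARD('k) ^ s" "k \<le> s"
  shows "card (power_span emb a k) = CARD('k) ^ k"
  using assms(2)
proof (induction k)
  case (Suc k)
  have "card (power_span emb a (Suc k)) = CARD('k) * card (power_span emb a k)"
  proof (rule card_subspace_step[OF vs.vector_space_axioms])
    show "a ^ k \<notin> power_span emb a k"
      using Suc by (intro power_notin_power_span[OF assms(1)]) simp
    show "\<exists>c. x - escale emb c (a ^ k) \<in> power_span emb a k"
      if "x \<in> power_span emb a (Suc k)" for x
      using that power_span_Suc_iff by (simp add: escale_def)
    show "power_span emb a k \<subseteq> power_span emb a (Suc k)"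
      by (rule power_span_mono) simp
  qed (auto intro: subspace_power_span power_in_power_span)
  with Suc show ?case by simp
qed simp

end


section \<open>Fibres of quotients of power spans\<close>

text \<open>The nonzero members are the denominators in \<open>T\<close> for which \<open>x\<close>
  is a quotient with numerator in \<open>S\<close>.\<close>

definition ratio_fibre :: "'e::field set \<Rightarrow> 'e set \<Rightarrow> 'e \<Rightarrow> 'e set" where
  "ratio_fibre S T x = {y \<in> T. x * y \<in> S}"

context finite_extension
begin

lemma subspace_ratio_fibre:
  assumes "vs.subspace S" "vs.subspace T"
  shows "vs.subspace (ratio_fibre S T x)"
  using assms unfolding subspace_iff ratio_fibre_def
  by (auto simp: distrib_left mult.left_commute[of x])

lemma card_ratio_fibre_pos:
  assumes "vs.subspace S" "vs.subspace T"
  shows "0 < card (ratio_fibre S T x)"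
  using vs.subspace_0[OF subspace_ratio_fibre[OF assms]] by (auto simp: card_gt_0_iff)

text \<open>This makes being nonzero the case \<open>i = 1\<close> of the threshold
  \<open>CARD('k) ^ i\<close>, by which points of weight at least \<open>i\<close> are
  counted.\<close>

lemma q_le_card_subspace_iff:
  assumes "vs.subspace V"
  shows "CARD('k) \<le> card V \<longleftrightarrow> V \<noteq> {0}"
proof -
  have card: "card V = CARD('k) ^ vs.dim V"
    by (rule card_finite_subspace[OF vs.vector_space_axioms assms]) simp
  have "V = {0}" if "card V = 1"
    using that vs.subspace_0[OF assms] by (auto simp: card_1_singleton_iff)
  then have "V \<noteq> {0} \<Longrightarrow> vs.dim V \<noteq> 0"
    using card by auto
  then show ?thesis
    using card q_ge_2 self_le_power[of "CARD('k)" "vs.dim V"] by (cases "V = {0}") auto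
qed

lemma power_span_reduce:
  assumes "x \<in> power_span emb a (Suc k)" "y \<in> power_span emb a (Suc k)" "y \<notin> power_span emb a k"
  shows "\<exists>c. x - emb c * y \<in> power_span emb a k"
proof -
  note sub = subspace_power_span[of a k]
  obtain c d where c: "x - emb c * a ^ k \<in> power_span emb a k"
    and d: "y - emb d * a ^ k \<in> power_span emb a k"
    using assms power_span_Suc_iff by metis
  have "d \<noteq> 0" using d assms(3) by auto
  \<comment> \<open>With leading coefficients \<open>c\<close> of \<open>x\<close> and
    \<open>d\<close> of \<open>y\<close>, subtracting \<open>c / d\<close> times \<open>y\<close>
    cancels the leading term of \<open>x\<close>.\<close>
  have "(x - emb c * a ^ k) - emb (c * inverse d) * (y - emb d * a ^ k) \<in> power_span emb a k"
    using c d vs.subspace_diff[OF sub] sub unfolding subspace_iff by blast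
  also have "(x - emb c * a ^ k) - emb (c * inverse d) * (y - emb d * a ^ k) = x - emb (c * inverse d) * y"
    using \<open>d \<noteq> 0\<close> by (simp add: algebra_simps)
  finally show ?thesis by blast
qed

context
  fixes a s
  assumes card_adjoin: "card (adjoin emb a) = CARD('k) ^ s"
begin

text \<open>Degrees in \<open>a\<close> add up as long as they stay below the degree \<open>s\<close> of \<open>a\<close>.\<close>

lemma mult_notin_power_span:
  assumes "y \<in> power_span emb a (Suc k)" "y \<notin> power_span emb a k"
    and "z \<in> power_span emb a (Suc i)" "z \<notin> power_span emb a i" and "i + k < s"
  shows "y * z \<notin> power_span emb a (i + k)"
proof
  note sub = subspace_power_span[of a "i + k"]
  assume yz: "y * z \<in> power_span emb a (i + k)"
  obtain c d where c: "y - emb c * a ^ k \<in> power_span emb a k"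
    and d: "z - emb d * a ^ i \<in> power_span emb a i"
    using assms power_span_Suc_iff by metis
  have "c \<noteq> 0" "d \<noteq> 0" using c d assms by auto
  \<comment> \<open>The products in \<open>1\<close> and \<open>2\<close> have degree below
    \<open>i + k\<close>. Removing the second and \<open>c\<close> times the first from
    \<open>y * z\<close> leaves exactly the term \<open>c * d * a ^ (i + k)\<close>.\<close>
  have 1: "a ^ k * (z - emb d * a ^ i) \<in> power_span emb a (i + k)"
    using mult_power_span[OF power_in_power_span[of k "Suc k" a] d] by (simp add: add.commute)
  have 2: "(y - emb c * a ^ k) * z \<in> power_span emb a (i + k)"
    using mult_power_span[OF c assms(3)] by (simp add: add.commute)
  have "emb c * (a ^ k * (z - emb d * a ^ i)) \<in> power_span emb a (i + k)"
    using sub 1 unfolding subspace_iff by blast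
  then have "y * z - (y - emb c * a ^ k) * z - emb c * (a ^ k * (z - emb d * a ^ i)) \<in> power_span emb a (i + k)"
    by (intro vs.subspace_diff[OF sub] yz 2)
  also have "y * z - (y - emb c * a ^ k) * z - emb c * (a ^ k * (z - emb d * a ^ i)) = emb (c * d) * a ^ (i + k)"
    by (simp add: algebra_simps power_add)
  finally have "emb (inverse (c * d)) * (emb (c * d) * a ^ (i + k)) \<in> power_span emb a (i + k)"
    using sub unfolding subspace_iff by blast
  also have "emb (inverse (c * d)) * (emb (c * d) * a ^ (i + k)) = emb (inverse (c * d) * (c * d)) * a ^ (i + k)"
    by (simp only: emb_simps mult.assoc)
  also have "inverse (c * d) * (c * d) = 1"
    using \<open>c \<noteq> 0\<close> \<open>d \<noteq> 0\<close> by (intro left_inverse) simp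
  finally show False
    using power_notin_power_span[OF card_adjoin assms(5)] by (simp only: emb_simps mult_1_left)
qed

text \<open>Multiplication by \<open>a\<close> raises the degree by one while degrees stay below
  \<open>s\<close>, so no element of \<open>V\<close> can have the highest degree that the current
  bound permits; the bound then descends to 0.\<close>

lemma generator_invariant_eq_0:
  assumes "V \<subseteq> power_span emb a k" "k < s" and inv: "\<And>x. x \<in> V \<Longrightarrow> a * x \<in> V"
  shows "V \<subseteq> {0}"
  using assms(1,2)
proof (induction k)
  case (Suc k)
  have "V \<subseteq> power_span emb a k"
  proof
    fix x assume x: "x \<in> V"
    show "x \<in> power_span emb a k"
    proof (rule ccontr)
      assume "x \<notin> power_span emb a k"
      \<comment> \<open>\<open>a\<close> has degree exactly one, since \<open>Suc k < s\<close>
        forces \<open>s > 1\<close>.\<close>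
      moreover have "a \<in> power_span emb a (Suc 1)" "a \<notin> power_span emb a 1"
        using power_in_power_span[of 1 2 a] power_notin_power_span[OF card_adjoin, of 1] Suc.prems
        by (auto simp: numeral_2_eq_2)
      ultimately have "x * a \<notin> power_span emb a (1 + k)"
        using Suc.prems x by (intro mult_notin_power_span) auto
      then show False
        using Suc.prems(1) inv[OF x] by (auto simp: mult.commute)
    qed
  qed
  with Suc show ?case by simp
qed simp

text \<open>
  For \<open>x\<close> represented by a reduced fraction of polynomials in \<open>a\<close>, the fibre consists of the
  multiples of the denominator by polynomials of bounded degree; lowering both bounds by one
  lowers this degree bound by one.
\<close>

lemma card_ratio_fibre_Suc:
  assumes "i + k < s"
    and ne: "ratio_fibre (power_span emb a (Suc i)) (power_span emb a (Suc k)) x \<noteq> {0}"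
  shows "card (ratio_fibre (power_span emb a (Suc i)) (power_span emb a (Suc k)) x) =
    CARD('k) * card (ratio_fibre (power_span emb a i) (power_span emb a k) x)"
    (is "card ?D = _ * card ?D'")
proof -
  let ?P = "power_span emb a"
  have subD: "vs.subspace ?D" and subD': "vs.subspace ?D'"
    by (intro subspace_ratio_fibre subspace_power_span)+
  have PSuc: "y \<in> ?P j \<Longrightarrow> y \<in> ?P (Suc j)" for y j
    using power_span_mono[of j "Suc j"] by auto
  have "?D' \<subseteq> ?D"
    by (auto simp: ratio_fibre_def PSuc)
  \<comment> \<open>If lowering the bounds lost nothing, both \<open>y\<close> and
    \<open>x * y\<close> would have room for one more factor \<open>a\<close>; the fibre would be
    invariant under \<open>a\<close> and hence zero.\<close>
  have "?D' \<noteq> ?D"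
  proof
    assume eq: "?D' = ?D"
    have "?D \<subseteq> ?P k" using eq by (auto simp: ratio_fibre_def)
    moreover have "a * y \<in> ?D" if "y \<in> ?D" for y
    proof -
      have "y \<in> ?P k" "x * y \<in> ?P i"
        using that eq by (auto simp: ratio_fibre_def)
      then show ?thesis
        using mult_generator_power_span[of y a k] mult_generator_power_span[of "x * y" a i]
        by (simp add: ratio_fibre_def mult.left_commute[of x])
    qed
    ultimately have "?D \<subseteq> {0}"
      using assms(1) by (intro generator_invariant_eq_0[of _ k]) auto
    then show False using ne vs.subspace_0[OF subD] by auto
  qed
  then obtain v where v: "v \<in> ?D" "v \<notin> ?D'"
    using \<open>?D' \<subseteq> ?D\<close> by blast
  \<comment> \<open>Suppose one fraction for \<open>x\<close> has only its numerator of full degree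
    and another only its denominator. Cross multiplication equates a product of degree exactly
    \<open>i + k\<close> with one of smaller degree.\<close>
  have "ratio_fibre (?P (Suc i)) (?P k) x \<subseteq> ratio_fibre (?P i) (?P (Suc k)) x \<or>
    ratio_fibre (?P i) (?P (Suc k)) x \<subseteq> ratio_fibre (?P (Suc i)) (?P k) x"
  proof (rule ccontr)
    assume "\<not> ?thesis"
    then obtain y u where y: "y \<in> ?P k" "x * y \<in> ?P (Suc i)" "x * y \<notin> ?P i"
      and u: "u \<in> ?P (Suc k)" "u \<notin> ?P k" "x * u \<in> ?P i"
      by (auto simp: ratio_fibre_def PSuc)
    have *: "k + i - 1 \<le> i + k" by simp
    have "u * (x * y) \<notin> ?P (i + k)"
      by (rule mult_notin_power_span) (use y u assms in auto)
    moreover have "y * (x * u) \<in> ?P (i + k)"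
      by (rule subsetD[OF power_span_mono[OF *] mult_power_span[OF y(1) u(3)]])
    ultimately show False by (simp add: ac_simps)
  qed
  then have "(\<forall>y\<in>?D. y \<in> ?P k \<longrightarrow> y \<in> ?D') \<or> (\<forall>y\<in>?D. x * y \<in> ?P i \<longrightarrow> y \<in> ?D')"
    unfolding ratio_fibre_def by blast
  \<comment> \<open>Within \<open>?D\<close>, one leading coefficient, that of \<open>y\<close> or
    that of \<open>x * y\<close>, now decides membership in \<open>?D'\<close>. It is nonzero for
    \<open>v\<close>, so a multiple of \<open>v\<close> cancels it.\<close>
  then have "\<exists>c. y - escale emb c v \<in> ?D'" if y: "y \<in> ?D" for y
  proof
    assume *: "\<forall>y\<in>?D. y \<in> ?P k \<longrightarrow> y \<in> ?D'"
    then have "v \<notin> ?P k" using v by blast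
    then obtain c where "y - emb c * v \<in> ?P k"
      using y v(1) power_span_reduce[of y a k v] by (auto simp: ratio_fibre_def)
    moreover have "y - emb c * v \<in> ?D"
      using vs.subspace_diff[OF subD y vs.subspace_scale[OF subD v(1)]] by (simp add: escale_def)
    ultimately have "y - emb c * v \<in> ?D'" using * by blast
    then show ?thesis by (auto simp: escale_def)
  next
    assume *: "\<forall>y\<in>?D. x * y \<in> ?P i \<longrightarrow> y \<in> ?D'"
    then have "x * v \<notin> ?P i" using v by blast
    then obtain c where "x * y - emb c * (x * v) \<in> ?P i"
      using y v(1) power_span_reduce[of "x * y" a i "x * v"] by (auto simp: ratio_fibre_def)
    then have "x * (y - emb c * v) \<in> ?P i" by (simp add: algebra_simps)
    moreover have "y - emb c * v \<in> ?D"
      using vs.subspace_diff[OF subD y vs.subspace_scale[OF subD v(1)]] by (simp add: escale_def)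
    ultimately have "y - emb c * v \<in> ?D'" using * by blast
    then show ?thesis by (auto simp: escale_def)
  qed
  then show ?thesis
    by (rule card_subspace_step[OF vs.vector_space_axioms subD subD' \<open>?D' \<subseteq> ?D\<close> v])
qed

end

section \<open>Double counting of nontrivial fibres\<close>

lemma sum_card_ratio_fibre:
  assumes "vs.subspace S" "vs.subspace T"
  shows "(\<Sum>x\<in>UNIV. card (ratio_fibre S T x) - 1) = (card T - 1) * card S"
proof -
  \<comment> \<open>Subtracting one discards \<open>y = 0\<close>, which lies in every
    fibre.\<close>
  have "(\<Sum>x\<in>UNIV. card (ratio_fibre S T x) - 1) = (\<Sum>x\<in>UNIV. card {y \<in> T - {0}. x * y \<in> S})"
  proof (rule sum.cong[OF refl])
    fix x
    have "{y \<in> T - {0}. x * y \<in> S} = ratio_fibre S T x - {0}"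
      by (auto simp: ratio_fibre_def)
    then show "card (ratio_fibre S T x) - 1 = card {y \<in> T - {0}. x * y \<in> S}"
      using vs.subspace_0[OF subspace_ratio_fibre[OF assms]] by (simp add: card_Diff_singleton)
  qed
  \<comment> \<open>Exchange the order of counting: a fixed \<open>y \<noteq> 0\<close> occurs
    exactly over the quotients \<open>z / y\<close> with \<open>z \<in> S\<close>.\<close>
  also have "\<dots> = (\<Sum>y\<in>T - {0}. card {x\<in>UNIV. x * y \<in> S})"
    by (rule sum_multicount_gen) auto
  also have "\<dots> = (\<Sum>y\<in>T - {0}. card S)"
  proof (rule sum.cong[OF refl])
    fix y assume y: "y \<in> T - {0}"
    have "bij_betw (\<lambda>x. x * y) {x\<in>UNIV. x * y \<in> S} S"
      using y by (intro bij_betwI[of _ _ _ "\<lambda>z. z / y"]) auto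
    then show "card {x\<in>UNIV. x * y \<in> S} = card S" by (rule bij_betw_same_card)
  qed
  also have "\<dots> = (card T - 1) * card S"
    using vs.subspace_0[OF assms(2)] by (simp add: card_Diff_singleton)
  finally show ?thesis .
qed

context
  fixes a s
  assumes card_adjoin: "card (adjoin emb a) = CARD('k) ^ s"
begin

text \<open>
  Count the pairs \<open>(x, y)\<close> with \<open>y \<noteq> 0\<close> in the fibre over \<open>x\<close>, for the given bounds and for both
  bounds lowered by one. Multiplying the second count by \<open>q\<close> and subtracting leaves \<open>q - 1\<close> for each
  nontrivial fibre.
\<close>

lemma card_nontrivial_ratio_fibre:
  assumes "i + k < s"
  shows "card {x. CARD('k) \<le> card (ratio_fibre (power_span emb a (Suc i)) (power_span emb a (Suc k)) x)} =
    CARD('k) ^ (i + k + 1)" (is "card ?A = _")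
proof -
  let ?q = "CARD('k)" and ?P = "power_span emb a"
  let ?D = "ratio_fibre (?P (Suc i)) (?P (Suc k))" and ?D' = "ratio_fibre (?P i) (?P k)"
  have pos: "0 < card (?D x)" "0 < card (?D' x)" for x
    by (intro card_ratio_fibre_pos subspace_power_span)+
  have A: "x \<in> ?A \<longleftrightarrow> ?D x \<noteq> {0}" for x
    using q_le_card_subspace_iff[OF subspace_ratio_fibre[OF subspace_power_span subspace_power_span]]
    by simp
  have "?D' x \<subseteq> ?D x" for x
    using power_span_mono[of i "Suc i"] power_span_mono[of k "Suc k"] by (auto simp: ratio_fibre_def)
  then have notA: "?D x = {0}" "?D' x = {0}" if "x \<notin> ?A" for x
    using that A[of x] vs.subspace_0[OF subspace_ratio_fibre[OF subspace_power_span subspace_power_span]]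
    by blast+
  \<comment> \<open>Fibres outside \<open>?A\<close> are zero and contribute nothing once their zero
    vector is discarded; inside \<open>?A\<close> the discarded vectors number
    \<open>card ?A\<close>.\<close>
  have sum_A: "(\<Sum>x\<in>?A. card (D x)) = (\<Sum>x\<in>UNIV. card (D x) - 1) + card ?A"
    if "\<And>x. 0 < card (D x)" "\<And>x. x \<notin> ?A \<Longrightarrow> D x = {0}" for D :: "'e \<Rightarrow> 'e set"
  proof -
    have "(\<Sum>x\<in>UNIV. card (D x) - 1) = (\<Sum>x\<in>?A. card (D x) - 1)"
      by (rule sum.mono_neutral_right) (use that(2) in auto)
    moreover have "(\<Sum>x\<in>?A. card (D x)) = (\<Sum>x\<in>?A. (card (D x) - 1) + 1)"
      using that(1) by (intro sum.cong) (auto simp: Suc_diff_1)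
    moreover have "\<dots> = (\<Sum>x\<in>?A. card (D x) - 1) + card ?A"
      by (simp add: sum.distrib del: One_nat_def)
    ultimately show ?thesis by linarith
  qed
  have "(\<Sum>x\<in>?A. card (?D x)) = (\<Sum>x\<in>?A. ?q * card (?D' x))"
  proof (rule sum.cong[OF refl])
    fix x assume "x \<in> ?A"
    then show "card (?D x) = ?q * card (?D' x)"
      using A[of x] by (intro card_ratio_fibre_Suc[OF card_adjoin assms]) auto
  qed
  also have "\<dots> = ?q * (\<Sum>x\<in>?A. card (?D' x))"
    by (simp add: sum_distrib_left)
  also have "(\<Sum>x\<in>?A. card (?D' x)) = (\<Sum>x\<in>UNIV. card (?D' x) - 1) + card ?A"
    by (rule sum_A[of ?D']) (rule pos(2), rule notA(2))
  also have "(\<Sum>x\<in>UNIV. card (?D' x) - 1) = (?q ^ k - 1) * ?q ^ i"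
    using assms card_power_span[OF card_adjoin, of i] card_power_span[OF card_adjoin, of k]
    by (simp only: sum_card_ratio_fibre[OF subspace_power_span subspace_power_span])
  also have "(\<Sum>x\<in>?A. card (?D x)) = (\<Sum>x\<in>UNIV. card (?D x) - 1) + card ?A"
    by (rule sum_A[of ?D]) (rule pos(1), rule notA(1))
  also have "(\<Sum>x\<in>UNIV. card (?D x) - 1) = (?q ^ Suc k - 1) * ?q ^ Suc i"
    using assms card_power_span[OF card_adjoin, of "Suc i"] card_power_span[OF card_adjoin, of "Suc k"]
    by (simp only: sum_card_ratio_fibre[OF subspace_power_span subspace_power_span])
  finally have "(?q ^ Suc k - 1) * ?q ^ Suc i + card ?A = ?q * ((?q ^ k - 1) * ?q ^ i + card ?A)" .
  \<comment> \<open>Over the integers the terms \<open>q ^ Suc i\<close> on both sides cancel, which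
    leaves a linear equation for \<open>card ?A\<close> with coefficient
    \<open>q - 1\<close>.\<close>
  then have "int ((?q ^ Suc k - 1) * ?q ^ Suc i + card ?A) = int (?q * ((?q ^ k - 1) * ?q ^ i + card ?A))"
    by (rule arg_cong)
  moreover have "int (?q ^ r - 1) = int ?q ^ r - 1" for r
    using one_le_power[of ?q r] q_ge_2 by (simp add: of_nat_diff)
  ultimately have "(int ?q ^ Suc k - 1) * int ?q ^ Suc i + int (card ?A) =
      int ?q * ((int ?q ^ k - 1) * int ?q ^ i + int (card ?A))"
    by (simp only: of_nat_add of_nat_mult of_nat_power)
  moreover have "(z - 1) * w = (z - 1) * z ^ (i + k + 1)"
    if "(z ^ Suc k - 1) * z ^ Suc i + w = z * ((z ^ k - 1) * z ^ i + w)" for z w :: int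
    using that by (simp add: algebra_simps power_add)
  ultimately have "(int ?q - 1) * int (card ?A) = (int ?q - 1) * int ?q ^ (i + k + 1)"
    by blast
  then have "int (card ?A) = int ?q ^ (i + k + 1)"
    using q_ge_2 by (subst (asm) mult_left_cancel) auto
  then show ?thesis by (metis of_nat_eq_iff of_nat_power)
qed

text \<open>Lowering \<open>t1\<close>, \<open>t2\<close> and \<open>i\<close> together preserves
  \<open>t1 + t2 + 1 - 2 * i\<close>, which reduces everything to the count for \<open>i = 1\<close>
  or to a zero span. The value 1 for \<open>t1 < i \<le> t2\<close> comes from \<open>x = 0\<close>,
  whose fibre is the whole denominator space. Since the induction reaches \<open>t1 = 0\<close>, the
  bound \<open>t2 \<le> s\<close> does not follow from the bound on the sum.\<close>

lemma card_ratio_fibre_ge: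
  assumes "t1 + t2 \<le> s + 1" "t2 \<le> s" "1 \<le> i"
  shows "card {x. CARD('k) ^ i \<le> card (ratio_fibre (power_span emb a t1) (power_span emb a t2) x)} =
    (if i \<le> t1 \<and> i \<le> t2 then CARD('k) ^ (t1 + t2 + 1 - 2 * i) else if i \<le> t2 then 1 else 0)"
  using assms
proof (induction t2 arbitrary: t1 i)
  case 0
  have "card (ratio_fibre (power_span emb a t1) {0} x) < CARD('k) ^ i" for x
  proof -
    have "card (ratio_fibre (power_span emb a t1) {0} x) \<le> card {0::'e}"
      by (rule card_mono) (auto simp: ratio_fibre_def)
    also have "\<dots> < CARD('k) ^ i"
      using one_less_power[of "CARD('k)" i] q_ge_2 0 by simp
    finally show ?thesis .
  qed
  then have "{x. CARD('k) ^ i \<le> card (ratio_fibre (power_span emb a t1) {0} x)} = {}"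
    by (auto simp: not_le)
  then show ?case using 0 by simp
next
  case (Suc k t1 i)
  let ?q = "CARD('k)" and ?P = "power_span emb a"
  show ?case
  proof (cases t1)
    case 0
    have card_T: "card (?P (Suc k)) = ?q ^ Suc k"
      using Suc.prems 0 by (intro card_power_span[OF card_adjoin]) simp
    have "ratio_fibre {0} (?P (Suc k)) x = (if x = 0 then ?P (Suc k) else {0})" for x
      using vs.subspace_0[OF subspace_power_span] by (auto simp: ratio_fibre_def)
    moreover have "\<not> ?q ^ i \<le> 1" "?q ^ i \<le> ?q ^ Suc k \<longleftrightarrow> i \<le> Suc k"
      using one_less_power[of ?q i] q_ge_2 Suc.prems by (auto simp del: power_Suc)
    ultimately have "{x. ?q ^ i \<le> card (ratio_fibre {0} (?P (Suc k)) x)} = (if i \<le> Suc k then {0} else {})"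
      using card_T by (auto simp del: power_Suc split: if_splits)
    then show ?thesis using 0 Suc.prems by simp
  next
    case t1: (Suc t)
    show ?thesis
    proof (cases "i = 1")
      case True
      then show ?thesis
        using card_nontrivial_ratio_fibre[of t k] Suc.prems t1 by simp
    next
      case False
      then obtain r where r: "i = Suc r" "1 \<le> r" using Suc.prems by (cases i) auto
      let ?D = "ratio_fibre (?P (Suc t)) (?P (Suc k))" and ?D' = "ratio_fibre (?P t) (?P k)"
      \<comment> \<open>A zero fibre misses both thresholds; for any other fibre the threshold and
        the cardinality lose the same factor \<open>?q\<close>.\<close>
      have "?q ^ i \<le> card (?D x) \<longleftrightarrow> ?q ^ r \<le> card (?D' x)" for x
      proof (cases "?D x = {0}")
        case True
        have "?D' x \<subseteq> ?D x"
          using power_span_mono[of t "Suc t"] power_span_mono[of k "Suc k"] by (auto simp: ratio_fibre_def)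
        then have "card (?D' x) \<le> 1" using True card_mono[of "{0}" "?D' x"] by auto
        moreover have "1 < ?q ^ i" "1 < ?q ^ r"
          using one_less_power[of ?q i] one_less_power[of ?q r] q_ge_2 r by (auto simp del: power_Suc)
        ultimately show ?thesis using True by auto
      next
        case False
        then show ?thesis
          using card_ratio_fibre_Suc[OF card_adjoin _ False] Suc.prems t1 r q_ge_2 by simp
      qed
      then show ?thesis
        using Suc.IH[of t r] Suc.prems t1 r by simp
    qed
  qed
qed

end

end


section \<open>Weights of points\<close>

lemma pg_point_eq: "pg_point v = range (\<lambda>c. (c * fst v, c * snd v))"
proof -
  interpret vector_space "escale2 (\<lambda>c::'a. c)"
    by (rule vector_space_escale2) (simp add: field_embedding_def)
  show ?thesis
    by (simp add: pg_point_def span_singleton escale2_def)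
qed

lemma generator_in_pg_point: "v \<in> pg_point v"
  unfolding pg_point_eq by (rule range_eqI[of _ _ 1]) simp

lemma zero_in_pg_point: "0 \<in> pg_point v"
  unfolding pg_point_eq by (rule range_eqI[of _ _ 0]) (simp add: zero_prod_def)

lemma mem_pg_point_affine: "(u, w) \<in> pg_point (x, 1) \<longleftrightarrow> u = x * w"
  by (auto simp: pg_point_eq mult.commute)

lemma mem_pg_point_infinity: "(u, w) \<in> pg_point (1, 0) \<longleftrightarrow> w = 0"
  by (auto simp: pg_point_eq)

lemma pg_point_scale:
  assumes "c \<noteq> 0"
  shows "pg_point (c * u, c * w) = pg_point (u, w)"
proof (intro equalityI subsetI)
  fix p assume "p \<in> pg_point (c * u, c * w)"
  then obtain d where "p = (d * (c * u), d * (c * w))"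
    by (auto simp: pg_point_eq)
  then have "p = ((d * c) * u, (d * c) * w)" by (simp add: mult.assoc)
  then show "p \<in> pg_point (u, w)" by (auto simp: pg_point_eq)
next
  fix p assume "p \<in> pg_point (u, w)"
  then obtain d where "p = (d * u, d * w)"
    by (auto simp: pg_point_eq)
  then have "p = ((d / c) * (c * u), (d / c) * (c * w))" using assms by simp
  then show "p \<in> pg_point (c * u, c * w)" unfolding pg_point_eq fst_conv snd_conv by (rule range_eqI)
qed

lemma pg_point_cases:
  assumes "v \<noteq> 0"
  obtains x where "pg_point v = pg_point (x, 1)" | "pg_point v = pg_point (1, 0)"
proof (cases "snd v = 0")
  case True
  then have "pg_point v = pg_point (1, 0)"
    using assms pg_point_scale[of "fst v" 1 0] by (cases v) (auto simp: zero_prod_def)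
  then show ?thesis by (rule that(2))
next
  case False
  then have "pg_point v = pg_point (fst v / snd v, 1)"
    using pg_point_scale[of "snd v" "fst v / snd v" 1] by (cases v) auto
  then show ?thesis by (rule that(1))
qed

lemma pg_point_eqI:
  assumes "u \<in> pg_point v" "u \<noteq> 0"
  shows "pg_point u = pg_point v"
proof -
  obtain c where c: "u = (c * fst v, c * snd v)"
    using assms(1) by (auto simp: pg_point_eq)
  then have "c \<noteq> 0" using assms(2) by (auto simp: zero_prod_def)
  then show ?thesis unfolding c by (simp add: pg_point_scale)
qed

lemma inj_pg_point_affine: "inj (\<lambda>x. pg_point (x, 1))"
  by (rule injI) (metis mem_pg_point_affine mult_1_right)

lemma pg_point_affine_neq_infinity: "pg_point (x, 1) \<noteq> pg_point (1, 0)"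
  by (metis mem_pg_point_affine mem_pg_point_infinity mult_1_right zero_neq_one)

section \<open>Weight classes and spectra of product subspaces\<close>

context finite_extension
begin

lemma card_Int_pg_point:
  assumes "vs2.subspace U"
  shows "card (U \<inter> pg_point v) = CARD('k) ^ weight emb U (pg_point v)"
  unfolding weight_def
proof (rule card_finite_subspace[OF vs2.vector_space_axioms])
  have "vs2.subspace (pg_point v)"
    unfolding vs2.subspace_def
  proof (intro conjI ballI allI zero_in_pg_point)
    fix x y assume "x \<in> pg_point v" "y \<in> pg_point v"
    then obtain c d where "x = (c * fst v, c * snd v)" "y = (d * fst v, d * snd v)"
      by (auto simp: pg_point_eq)
    then have "x + y = ((c + d) * fst v, (c + d) * snd v)" by (simp add: distrib_right)
    then show "x + y \<in> pg_point v" unfolding pg_point_eq by (rule range_eqI)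
  next
    fix k x assume "x \<in> pg_point v"
    then obtain c where "x = (c * fst v, c * snd v)" by (auto simp: pg_point_eq)
    then have "escale2 emb k x = ((emb k * c) * fst v, (emb k * c) * snd v)"
      by (simp add: escale2_def mult.assoc)
    then show "escale2 emb k x \<in> pg_point v" unfolding pg_point_eq by (rule range_eqI)
  qed
  then show "vs2.subspace (U \<inter> pg_point v)"
    using assms by (rule vs2.subspace_inter[rotated])
qed simp

text \<open>Points outside the linear set are those of weight 0, so for \<open>i \<ge> 1\<close> the
  points of weight \<open>i\<close> may be counted over the whole projective line.\<close>

lemma mem_linear_set_iff:
  assumes "vs2.subspace U"
  shows "P \<in> linear_set U \<longleftrightarrow> (\<exists>v. v \<noteq> 0 \<and> P = pg_point v) \<and> 1 \<le> weight emb U P"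
proof
  assume "P \<in> linear_set U"
  then obtain v where v: "v \<in> U" "v \<noteq> 0" "P = pg_point v" by (auto simp: linear_set_def)
  have "{0, v} \<subseteq> U \<inter> pg_point v"
    using v(1) vs2.subspace_0[OF assms] generator_in_pg_point[of v] zero_in_pg_point[of v] by simp
  then have "card {0, v} \<le> card (U \<inter> pg_point v)" by (intro card_mono) auto
  then have "weight emb U P \<noteq> 0"
    using card_Int_pg_point[OF assms, of v] v(2,3) by (intro notI) simp
  then show "(\<exists>v. v \<noteq> 0 \<and> P = pg_point v) \<and> 1 \<le> weight emb U P"
    using v(2,3) by (intro conjI exI[of _ v]) simp_all
next
  assume "(\<exists>v. v \<noteq> 0 \<and> P = pg_point v) \<and> 1 \<le> weight emb U P"
  then obtain v where v: "P = pg_point v" "1 \<le> weight emb U (pg_point v)" by auto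
  then have "1 < card (U \<inter> pg_point v)"
    using card_Int_pg_point[OF assms, of v] q_ge_2
    one_less_power[of "CARD('k)" "weight emb U (pg_point v)"] by simp
  then have "\<not> U \<inter> pg_point v \<subseteq> {0}"
    using card_mono[of "{0}" "U \<inter> pg_point v"] by auto
  then obtain u where "u \<in> U" "u \<in> pg_point v" "u \<noteq> 0" by blast
  then have "P = pg_point u" "u \<in> U - {0}"
    using pg_point_eqI[of u v] v(1) by simp_all
  then show "P \<in> linear_set U"
    unfolding linear_set_def by (rule image_eqI)
qed

context
  fixes S T :: "'e set"
  assumes S: "vs.subspace S" and T: "vs.subspace T"
begin

lemma subspace_Times: "vs2.subspace (S \<times> T)"
  using S T unfolding subspace_iff vs2.subspace_def
  by (auto simp: zero_prod_def escale2_def)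

lemma weight_affine: "CARD('k) ^ weight emb (S \<times> T) (pg_point (x, 1)) = card (ratio_fibre S T x)"
proof -
  have "bij_betw (\<lambda>y. (x * y, y)) (ratio_fibre S T x) (S \<times> T \<inter> pg_point (x, 1))"
    by (rule bij_betwI[of _ _ _ snd]) (auto simp: ratio_fibre_def mem_pg_point_affine)
  from bij_betw_same_card[OF this] show ?thesis
    by (simp add: card_Int_pg_point[OF subspace_Times])
qed

lemma weight_infinity: "CARD('k) ^ weight emb (S \<times> T) (pg_point (1, 0)) = card S"
proof -
  have "S \<times> T \<inter> pg_point (1, 0) = S \<times> {0}"
    using vs.subspace_0[OF T] by (auto simp: mem_pg_point_infinity)
  then show ?thesis
    using card_Int_pg_point[OF subspace_Times, of "(1, 0)"] by (simp add: card_cartesian_product)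
qed

text \<open>The sets of affine points of weight at least \<open>i\<close> are nested, so their
  successive differences give the exact weights. The point at infinity, whose weight is the
  dimension of \<open>S\<close>, is added separately.\<close>

lemma card_weight_class:
  assumes "1 \<le> i"
  shows "card {P \<in> linear_set (S \<times> T). weight emb (S \<times> T) P = i} =
    card {x. CARD('k) ^ i \<le> card (ratio_fibre S T x)} -
    card {x. CARD('k) ^ Suc i \<le> card (ratio_fibre S T x)} + (if card S = CARD('k) ^ i then 1 else 0)"
proof -
  let ?w = "weight emb (S \<times> T)"
  have eq_iff: "CARD('k) ^ j = CARD('k) ^ r \<longleftrightarrow> j = r" for j r :: nat
    using power_inject_exp[of "CARD('k)"] q_ge_2 by simp
  have le_iff: "CARD('k) ^ j \<le> CARD('k) ^ r \<longleftrightarrow> j \<le> r" for j r :: nat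
    using power_increasing_iff[of "CARD('k)"] q_ge_2 by simp
  define A where "A = {x. ?w (pg_point (x, 1)) = i}"
  define Z where "Z = (if card S = CARD('k) ^ i then {pg_point (1, 0) :: ('e \<times> 'e) set} else {})"
  have Z: "Z = (if ?w (pg_point (1, 0)) = i then {pg_point (1, 0)} else {})"
    unfolding Z_def weight_infinity[symmetric] eq_iff ..
  have "P \<in> linear_set (S \<times> T) \<and> ?w P = i \<longleftrightarrow> P \<in> (\<lambda>x. pg_point (x, 1)) ` A \<union> Z" (is "?L \<longleftrightarrow> ?R") for P
  proof
    assume L: ?L
    then obtain v where "v \<noteq> 0" "P = pg_point v"
      using mem_linear_set_iff[OF subspace_Times] by blast
    then show ?R
      using L by (cases rule: pg_point_cases[of v]) (auto simp: A_def Z)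
  next
    assume ?R
    then consider x where "?w (pg_point (x, 1)) = i" "P = pg_point (x, 1)"
      | "?w (pg_point (1, 0)) = i" "P = pg_point (1, 0)"
      unfolding Z A_def by (auto split: if_splits)
    moreover have "(x, 1 :: 'e) \<noteq> 0" "(1 :: 'e, 0 :: 'e) \<noteq> 0" for x :: 'e
      by (auto simp: zero_prod_def)
    ultimately have "(\<exists>v. v \<noteq> 0 \<and> P = pg_point v) \<and> ?w P = i"
      by cases blast+
    then show ?L
      using assms mem_linear_set_iff[OF subspace_Times, of P] by simp
  qed
  then have "{P \<in> linear_set (S \<times> T). ?w P = i} = (\<lambda>x. pg_point (x, 1)) ` A \<union> Z" by blast
  moreover have "(\<lambda>x. pg_point (x, 1)) ` A \<inter> Z = {}"
    using pg_point_affine_neq_infinity by (auto simp: Z_def)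
  ultimately have "card {P \<in> linear_set (S \<times> T). ?w P = i} = card ((\<lambda>x. pg_point (x, 1::'e)) ` A) + card Z"
    by (simp add: card_Un_disjoint)
  also have "card ((\<lambda>x. pg_point (x, 1::'e)) ` A) = card A"
    by (intro card_image inj_on_subset[OF inj_pg_point_affine]) auto
  also have "A = {x. CARD('k) ^ i \<le> card (ratio_fibre S T x)} - {x. CARD('k) ^ Suc i \<le> card (ratio_fibre S T x)}"
    unfolding A_def weight_affine[symmetric] le_iff by auto
  also have "card \<dots> = card {x. CARD('k) ^ i \<le> card (ratio_fibre S T x)} -
    card {x. CARD('k) ^ Suc i \<le> card (ratio_fibre S T x)}"
    unfolding weight_affine[symmetric] le_iff by (rule card_Diff_subset) auto
  finally show ?thesis by (simp add: Z_def)
qed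

lemma mem_weight_spectrum_iff_card:
  "i \<in> weight_spectrum emb (S \<times> T) \<longleftrightarrow>
    1 \<le> i \<and> card {P \<in> linear_set (S \<times> T). weight emb (S \<times> T) P = i} \<noteq> 0"
  using mem_linear_set_iff[OF subspace_Times] by (auto simp: weight_spectrum_def)

lemma mem_weight_spectrum_iff:
  "i \<in> weight_spectrum emb (S \<times> T) \<longleftrightarrow> 1 \<le> i \<and> (card S = CARD('k) ^ i \<or>
    card {x. CARD('k) ^ i \<le> card (ratio_fibre S T x)} \<noteq>
    card {x. CARD('k) ^ Suc i \<le> card (ratio_fibre S T x)})"
proof -
  have "CARD('k) ^ i \<le> CARD('k) ^ Suc i"
    using q_ge_2 by (intro power_increasing) auto
  then have "card {x. CARD('k) ^ Suc i \<le> card (ratio_fibre S T x)} \<le>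
    card {x. CARD('k) ^ i \<le> card (ratio_fibre S T x)}"
    by (intro card_mono) (auto simp del: power_Suc)
  moreover have "card {P \<in> linear_set (S \<times> T). weight emb (S \<times> T) P = i} \<noteq> 0 \<longleftrightarrow> card S = CARD('k) ^ i \<or>
    card {x. CARD('k) ^ i \<le> card (ratio_fibre S T x)} \<noteq>
    card {x. CARD('k) ^ Suc i \<le> card (ratio_fibre S T x)}" if "1 \<le> i"
    using calculation unfolding card_weight_class[OF that] by auto
  ultimately show ?thesis
    unfolding mem_weight_spectrum_iff_card by blast
qed

end

text \<open>The threshold counts fix the affine part of every weight class, and
  \<open>card S\<close> fixes the weight of the point at infinity.\<close>

lemma weight_distribution_eqI:
  assumes "vs.subspace S" "vs.subspace T" "vs.subspace S'" "vs.subspace T'" and "card S = card S'"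
    and "\<And>i. 1 \<le> i \<Longrightarrow> card {x. CARD('k) ^ i \<le> card (ratio_fibre S T x)} =
      card {x. CARD('k) ^ i \<le> card (ratio_fibre S' T' x)}"
  shows "weight_spectrum emb (S \<times> T) = weight_spectrum emb (S' \<times> T')"
    and "weight_distribution emb (S \<times> T) = weight_distribution emb (S' \<times> T')"
proof -
  have card_eq: "card {P \<in> linear_set (S \<times> T). weight emb (S \<times> T) P = i} =
      card {P \<in> linear_set (S' \<times> T'). weight emb (S' \<times> T') P = i}" if "1 \<le> i" for i
    using that card_weight_class[OF assms(1,2) that] card_weight_class[OF assms(3,4) that]
      assms(5) assms(6)[of i] assms(6)[of "Suc i"] by simp
  then show eq: "weight_spectrum emb (S \<times> T) = weight_spectrum emb (S' \<times> T')"
    unfolding set_eq_iff mem_weight_spectrum_iff_card[OF assms(1,2)] mem_weight_spectrum_iff_card[OF assms(3,4)]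
    by (intro allI conj_cong refl) (simp only: card_eq)
  show "weight_distribution emb (S \<times> T) = weight_distribution emb (S' \<times> T')"
    unfolding weight_distribution_def eq Setcompr_eq_image
  proof (rule image_cong[OF refl])
    fix i assume "i \<in> weight_spectrum emb (S' \<times> T')"
    then have "1 \<le> i" unfolding mem_weight_spectrum_iff_card[OF assms(3,4)] by (rule conjunct1)
    then show "(i, card {P \<in> linear_set (S \<times> T). weight emb (S \<times> T) P = i}) =
        (i, card {P \<in> linear_set (S' \<times> T'). weight emb (S' \<times> T') P = i})"
      by (simp only: card_eq)
  qed
qed

text \<open>The threshold counts drop strictly at every \<open>i \<le> min t1 t2\<close>. The weight
  \<open>t1\<close> occurs at infinity and \<open>t2\<close> at the point over 0; the larger of the
  two may lie above the initial segment.\<close>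

lemma mem_weight_spectrum_power_span_iff:
  assumes "card (adjoin emb a) = CARD('k) ^ s" "1 \<le> t1" "1 \<le> t2" "t1 + t2 \<le> s + 1"
  shows "i \<in> weight_spectrum emb (power_span emb a t1 \<times> power_span emb a t2) \<longleftrightarrow>
    1 \<le> i \<and> i \<le> min t1 t2 \<or> i = max t1 t2"
proof (cases "1 \<le> i")
  case True
  let ?E = "\<lambda>i. if i \<le> t1 \<and> i \<le> t2 then CARD('k) ^ (t1 + t2 + 1 - 2 * i) else if i \<le> t2 then 1 else 0"
  have inj: "CARD('k) ^ j = CARD('k) ^ r \<longleftrightarrow> j = r" for j r :: nat
    using power_inject_exp[of "CARD('k)"] q_ge_2 by simp
  have inj1: "CARD('k) ^ j = 1 \<longleftrightarrow> j = 0" for j :: nat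
    using inj[of j 0] by simp
  have "i \<in> weight_spectrum emb (power_span emb a t1 \<times> power_span emb a t2) \<longleftrightarrow>
      t1 = i \<or> ?E i \<noteq> ?E (Suc i)"
    using mem_weight_spectrum_iff[OF subspace_power_span subspace_power_span, of i a t1 a t2] True assms
    by (simp add: card_power_span card_ratio_fibre_ge inj del: power_Suc)
  also have "\<dots> \<longleftrightarrow> 1 \<le> i \<and> i \<le> min t1 t2 \<or> i = max t1 t2"
    using True q_ge_2 by (auto simp: inj inj1 min_def max_def)
  finally show ?thesis .
next
  case False
  then show ?thesis
    using mem_weight_spectrum_iff[OF subspace_power_span subspace_power_span, of i a t1 a t2] assms
    by auto
qed

end


section \<open>Adding an independent subspace over a larger field\<close>

context finite_extension
begin

lemma nonzero_in_fibre:
  assumes "1 \<le> i" "CARD('k) ^ i \<le> card (ratio_fibre S T x)"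
  obtains y where "y \<in> T" "y \<noteq> 0" "x * y \<in> S"
proof -
  have "1 < CARD('k) ^ i" using one_less_power[of "CARD('k)" i] q_ge_2 assms(1) by simp
  then have "\<not> ratio_fibre S T x \<subseteq> {0}"
    using assms(2) card_mono[of "{0}" "ratio_fibre S T x"] by auto
  then show ?thesis using that by (auto simp: ratio_fibre_def)
qed

context
  fixes K V :: "'e set" and b :: 'e
  assumes K: "is_subfield K" "range emb \<subseteq> K"
    and V: "0 \<in> V" "\<And>x y. x \<in> V \<Longrightarrow> y \<in> V \<Longrightarrow> x + y \<in> V" "\<And>c x. c \<in> K \<Longrightarrow> x \<in> V \<Longrightarrow> c * x \<in> V"
    and b: "b \<noteq> 0" "V \<inter> {b * x | x. x \<in> K} = {0}"
begin

lemma subfield_closed: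
  "x \<in> K \<Longrightarrow> y \<in> K \<Longrightarrow> x - y \<in> K" "x \<in> K \<Longrightarrow> y \<in> K \<Longrightarrow> x * y \<in> K" "x \<in> K \<Longrightarrow> inverse x \<in> K"
  using K(1) unfolding is_subfield_def by blast+

lemma subspace_diff_V: "x \<in> V \<Longrightarrow> y \<in> V \<Longrightarrow> x - y \<in> V"
proof -
  assume *: "x \<in> V" "y \<in> V"
  have "1 \<in> K" "0 \<in> K" using K(1) unfolding is_subfield_def by blast+
  then have "- 1 \<in> K" using subfield_closed(1)[of 0 1] by simp
  then have "- 1 * y \<in> V" using V(3) * by blast
  then show ?thesis using V(2)[OF *(1), of "- 1 * y"] by simp
qed

text \<open>Two decompositions differ by an element of \<open>V\<close> that is also
  \<open>b\<close> times an element of \<open>K\<close>.\<close>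

lemma decomposition_unique:
  assumes "x \<in> V" "x' \<in> V" "z \<in> K" "z' \<in> K" "x + b * z = x' + b * z'"
  shows "x = x'" "z = z'"
proof -
  have eq: "x - x' = b * (z' - z)" using assms(5) by (simp add: algebra_simps)
  have "x - x' \<in> V" using assms subspace_diff_V by blast
  moreover have "z' - z \<in> K" using assms subfield_closed(1) by blast
  ultimately have "x - x' \<in> V \<inter> {b * x | x. x \<in> K}" using eq by blast
  then have "x - x' = 0" unfolding b(2) by simp
  then show "x = x'" "z = z'" using eq b(1) by simp_all
qed

lemma subspace_extended:
  assumes A: "vs.subspace A"
  shows "vs.subspace {x + b * y | x y. x \<in> V \<and> y \<in> A}"
  unfolding vs.subspace_def
proof (intro conjI ballI allI)
  have "0 = 0 + b * 0" by simp
  then show "0 \<in> {x + b * y | x y. x \<in> V \<and> y \<in> A}"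
    using V(1) vs.subspace_0[OF A] by blast
next
  fix u w assume "u \<in> {x + b * y | x y. x \<in> V \<and> y \<in> A}" "w \<in> {x + b * y | x y. x \<in> V \<and> y \<in> A}"
  then obtain x y x' y' where *: "x \<in> V" "x' \<in> V" "y \<in> A" "y' \<in> A" "u = x + b * y" "w = x' + b * y'"
    by blast
  then have "u + w = (x + x') + b * (y + y')" by (simp add: algebra_simps)
  then show "u + w \<in> {x + b * y | x y. x \<in> V \<and> y \<in> A}"
    using V(2)[OF *(1,2)] vs.subspace_add[OF A *(3,4)] by blast
next
  fix c u assume "u \<in> {x + b * y | x y. x \<in> V \<and> y \<in> A}"
  then obtain x y where *: "x \<in> V" "y \<in> A" "u = x + b * y"
    by blast
  have "escale emb c u = emb c * x + b * escale emb c y"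
    by (simp add: * escale_def algebra_simps)
  moreover have "emb c * x \<in> V" by (rule V(3)) (use K(2) * in auto)
  ultimately show "escale emb c u \<in> {x + b * y | x y. x \<in> V \<and> y \<in> A}"
    using vs.subspace_scale[OF A *(2)] by blast
qed

lemma card_extended_subset:
  assumes "C \<subseteq> K"
  shows "card {x + b * y | x y. x \<in> V \<and> y \<in> C} = card V * card C"
proof -
  have "{x + b * y | x y. x \<in> V \<and> y \<in> C} = (\<lambda>(x, y). x + b * y) ` (V \<times> C)" by auto
  moreover have "inj_on (\<lambda>(x, y). x + b * y) (V \<times> C)"
  proof (rule inj_onI, clarify)
    fix x y x' y' assume "x \<in> V" "y \<in> C" "x' \<in> V" "y' \<in> C" "x + b * y = x' + b * y'"
    then show "x = x' \<and> y = y'"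
      using decomposition_unique[of x x' y y'] assms by blast
  qed
  ultimately show ?thesis by (simp add: card_image card_cartesian_product)
qed

text \<open>For \<open>y \<in> K\<close>, the product \<open>(x + b * z) * y\<close> has components
  \<open>y * x \<in> V\<close> and \<open>z * y \<in> K\<close>, so uniqueness of the decomposition
  leaves a condition on \<open>z * y\<close> alone.\<close>

lemma ratio_fibre_extended:
  assumes A: "A \<subseteq> K" and B: "B \<subseteq> K" and xz: "x \<in> V" "z \<in> K"
  shows "ratio_fibre {x + b * y | x y. x \<in> V \<and> y \<in> A} B (x + b * z) = ratio_fibre A B z"
proof -
  have "(x + b * z) * y \<in> {x + b * y | x y. x \<in> V \<and> y \<in> A} \<longleftrightarrow> z * y \<in> A" if "y \<in> B" for y
  proof -
    have y: "y \<in> K" using that B by blast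
    have eq: "(x + b * z) * y = y * x + b * (z * y)" by (simp add: algebra_simps)
    have yx: "y * x \<in> V" by (rule V(3)[OF y xz(1)])
    have zy: "z * y \<in> K" by (rule subfield_closed(2)[OF xz(2) y])
    show ?thesis
    proof
      assume "(x + b * z) * y \<in> {x + b * y | x y. x \<in> V \<and> y \<in> A}"
      then obtain u w where "u \<in> V" "w \<in> A" "y * x + b * (z * y) = u + b * w"
        unfolding eq by blast
      then show "z * y \<in> A"
        using decomposition_unique(2)[OF yx _ zy] A by blast
    next
      assume "z * y \<in> A"
      then show "(x + b * z) * y \<in> {x + b * y | x y. x \<in> V \<and> y \<in> A}"
        unfolding eq using yx by blast
    qed
  qed
  then show ?thesis unfolding ratio_fibre_def by blast
qed

text \<open>Only elements of \<open>V + b * K\<close> can have a nonzero fibre, and each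
  \<open>z\<close> in the smaller configuration is covered by the \<open>card V\<close> elements
  \<open>x + b * z\<close>.\<close>

lemma card_ratio_fibre_extended_ge:
  assumes A: "A \<subseteq> K" and B: "B \<subseteq> K" and i: "1 \<le> i"
  shows "card {z. CARD('k) ^ i \<le> card (ratio_fibre {x + b * y | x y. x \<in> V \<and> y \<in> A} B z)} =
    card V * card {z. CARD('k) ^ i \<le> card (ratio_fibre A B z)}"
proof -
  let ?S = "{x + b * y | x y. x \<in> V \<and> y \<in> A}"
  let ?C = "{z. CARD('k) ^ i \<le> card (ratio_fibre A B z)}"
  \<comment> \<open>A nonzero fibre exhibits \<open>z\<close> as a quotient of two elements of the
    field \<open>K\<close>.\<close>
  have sub: "?C \<subseteq> K"
  proof
    fix z assume "z \<in> ?C"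
    then obtain y where y: "y \<in> B" "y \<noteq> 0" "z * y \<in> A"
      using nonzero_in_fibre[OF i] by blast
    have "z * y \<in> K" using y(3) A by blast
    moreover have "inverse y \<in> K" using y(1) B subfield_closed(3) by blast
    ultimately have "z * y * inverse y \<in> K" by (rule subfield_closed(2))
    also have "z * y * inverse y = z" using y(2) by simp
    finally show "z \<in> K" .
  qed
  have "z \<in> {x + b * y | x y. x \<in> V \<and> y \<in> ?C}"
    if z: "CARD('k) ^ i \<le> card (ratio_fibre ?S B z)" for z
  proof -
    obtain y where y: "y \<in> B" "y \<noteq> 0" "z * y \<in> ?S"
      using nonzero_in_fibre[OF i z] by blast
    then obtain u w where uw: "u \<in> V" "w \<in> A" "z * y = u + b * w" by blast
    have inv: "inverse y \<in> K" using y(1) B by (intro subfield_closed(3)) auto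
    \<comment> \<open>Dividing by the denominator \<open>y \<in> K\<close> keeps the
      \<open>V\<close> component in \<open>V\<close> and the other one in
      \<open>b * K\<close>.\<close>
    have "z = z * y * inverse y" using y(2) by simp
    also have "\<dots> = inverse y * u + b * (w * inverse y)"
      unfolding uw(3) by (simp add: algebra_simps)
    finally have eq: "z = inverse y * u + b * (w * inverse y)" .
    have 1: "inverse y * u \<in> V" by (rule V(3)[OF inv uw(1)])
    have 2: "w * inverse y \<in> K" using uw(2) A inv by (intro subfield_closed(2)) auto
    have "w * inverse y \<in> ?C"
      using z ratio_fibre_extended[OF A B 1 2] unfolding eq by simp
    then show ?thesis using eq 1 by blast
  qed
  moreover have "CARD('k) ^ i \<le> card (ratio_fibre ?S B (x + b * z))" if "x \<in> V" "z \<in> ?C" for x z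
    using that sub ratio_fibre_extended[OF A B, of x z] by auto
  ultimately have "{z. CARD('k) ^ i \<le> card (ratio_fibre ?S B z)} = {x + b * y | x y. x \<in> V \<and> y \<in> ?C}"
    by blast
  then show ?thesis using card_extended_subset[OF sub] by simp
qed

end

end

section \<open>Comparison of \<open>U\<close> with products of power spans\<close>

theorem theorem4p3:
  fixes emb :: "'q::{field,finite} \<Rightarrow> 'qn::{field,finite}"
    and embt :: "'qt::{field,finite} \<Rightarrow> 'qn"
    and q n l' t l m j :: nat
    and \<mu> b :: 'qn
    and Sbar S T :: "'qn set"
    and U :: "('qn \<times> 'qn) set"
  assumes "primepow q" and "l' > 1" and "t > 1" and "n = l' * t"
    and "CARD('q) = q" and "CARD('qt) = q ^ t" and "CARD('qn) = q ^ n"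
    and "field_embedding emb" and "field_embedding embt"
    and "\<mu> \<noteq> 0" and "adjoin emb \<mu> = range embt"
    and "module.subspace (escale embt) Sbar"
    and "vector_space.dim (escale embt) Sbar = l"
    and "1 \<le> l" and "l < l'"
    and "b \<noteq> 0" and "Sbar \<inter> {b * x | x. x \<in> range embt} = {0}"
    and "m > 0" and "j > 0" and "m + j \<le> t + 1"
    and "S = {x + b * y | x y. x \<in> Sbar \<and> y \<in> power_span emb \<mu> m}"
    and "T = power_span emb \<mu> j"
    and "U = S \<times> T"
  shows "(j \<le> m \<longrightarrow>
           (\<exists>W. is_JVdV emb W \<and> weight_spectrum emb W = weight_spectrum emb U \<and>
                weight_distribution emb W = weight_distribution emb U)) \<and>
         (j > m \<longrightarrow>
           ((\<exists>W. is_JVdV emb W \<and> weight_spectrum emb W = weight_spectrum emb U \<and>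
                weight_distribution emb W = weight_distribution emb U) \<longleftrightarrow> j = m + 1))"
proof -
  interpret F: finite_extension emb by unfold_locales fact
  interpret Ft: finite_extension embt by unfold_locales fact
  note q = \<open>CARD('q) = q\<close>
  have q2: "q \<ge> 2" using F.q_ge_2 q by simp
  define K where "K = range embt"
  have gen\<mu>: "card (adjoin emb \<mu>) = CARD('q) ^ t"
    using assms(5,6,11) by (simp add: card_image Ft.inj_emb)
  have K: "is_subfield K" "range emb \<subseteq> K"
    using Ft.range_subfield F.range_subset_adjoin[of \<mu>] assms(11) by (simp_all add: K_def)
  have add: "x + y \<in> Sbar" if "x \<in> Sbar" "y \<in> Sbar" for x y
    using assms(12) that unfolding Ft.subspace_iff by blast
  have scale: "c * x \<in> Sbar" if "c \<in> K" "x \<in> Sbar" for c x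
    using assms(12) that unfolding Ft.subspace_iff K_def by blast
  have zero: "0 \<in> Sbar" using assms(12) Ft.vs.subspace_0 by blast
  have disj: "Sbar \<inter> {b * x | x. x \<in> K} = {0}" using assms(17) by (simp only: K_def)
  have PK: "power_span emb \<mu> i \<subseteq> K" for i
    using F.power_span_subset_adjoin[of \<mu> i] assms(11) by (simp add: K_def)
  note P = F.subspace_power_span
  have card_Sbar: "card Sbar = q ^ (t * l)"
    using card_finite_subspace[OF Ft.vs.vector_space_axioms assms(12)] assms(6,13)
    by (simp add: power_mult)
  note ext = K zero add scale \<open>b \<noteq> 0\<close> disj
  have extended: "F.vs.subspace S" "card S = q ^ (t * l + m)"
    "\<And>i. 1 \<le> i \<Longrightarrow> card {x. q ^ i \<le> card (ratio_fibre S T x)} =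
      q ^ (t * l) * (if i \<le> m \<and> i \<le> j then q ^ (m + j + 1 - 2 * i) else if i \<le> j then 1 else 0)"
  proof -
    show "F.vs.subspace S"
      unfolding assms(21)
      by (rule F.subspace_extended[OF ext P])
    have "card S = card Sbar * card (power_span emb \<mu> m)"
      unfolding assms(21)
      by (rule F.card_extended_subset[OF ext PK])
    then show "card S = q ^ (t * l + m)"
      using F.card_power_span[OF gen\<mu>, of m] assms(19,20) card_Sbar q by (simp add: power_add)
    fix i :: nat assume i: "1 \<le> i"
    have "card {x. CARD('q) ^ i \<le> card (ratio_fibre S T x)} =
        card Sbar * card {x. CARD('q) ^ i \<le> card (ratio_fibre (power_span emb \<mu> m) (power_span emb \<mu> j) x)}"
      unfolding assms(21,22)
      by (rule F.card_ratio_fibre_extended_ge[OF ext PK PK i])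
    also have "card {x. CARD('q) ^ i \<le> card (ratio_fibre (power_span emb \<mu> m) (power_span emb \<mu> j) x)} =
        (if i \<le> m \<and> i \<le> j then CARD('q) ^ (m + j + 1 - 2 * i) else if i \<le> j then 1 else 0)"
      by (rule F.card_ratio_fibre_ge[OF gen\<mu> assms(20) _ i]) (use assms(18,20) in simp)
    finally show "card {x. q ^ i \<le> card (ratio_fibre S T x)} =
        q ^ (t * l) * (if i \<le> m \<and> i \<le> j then q ^ (m + j + 1 - 2 * i) else if i \<le> j then 1 else 0)"
      unfolding q card_Sbar .
  qed
  have T: "F.vs.subspace T" using P assms(22) by simp
  \<comment> \<open>The first bound comes from \<open>1 \<le> l\<close>, the second from
    \<open>Suc l \<le> l'\<close>.\<close>
  have tl: "t \<le> t * l" "t * l + t \<le> n"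
    using assms(4,14,15) mult_le_mono2[of "Suc l" l' t] by (simp_all add: mult.commute)
  have exists: "\<exists>W. is_JVdV emb W \<and> weight_spectrum emb W = weight_spectrum emb U \<and>
                weight_distribution emb W = weight_distribution emb U" if jm: "j \<le> m + 1"
  proof -
    obtain g :: 'qn where g: "\<And>x. x \<noteq> 0 \<Longrightarrow> \<exists>i::nat. x = g ^ i"
      using finite_field_primitive_element by blast
    \<comment> \<open>Powers of \<open>g\<close> exhaust the nonzero elements, so a subfield
      containing \<open>g\<close> is everything.\<close>
    have "x \<in> L" if "is_subfield L" "g \<in> L" for x and L :: "'qn set"
      using g[of x] F.subfield_power[OF that] that(1) unfolding is_subfield_def by (cases "x = 0") auto
    then have UNIV: "L = UNIV" if "is_subfield L" "g \<in> L" for L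
      using that by blast
    have "adjoin emb g = UNIV"
      by (rule UNIV[OF F.subfield_adjoin F.generator_in_adjoin])
    then have geng: "card (adjoin emb g) = CARD('q) ^ n" using assms(5,7) by simp
    have "n > 1" using tl assms(3) by simp
    have "g \<notin> range emb"
    proof
      assume "g \<in> range emb"
      then have "range emb = UNIV" by (rule UNIV[OF F.range_subfield])
      then have "q ^ n = q ^ 1"
        using assms(5,7) card_image[OF F.inj_emb] by simp
      then show False using \<open>n > 1\<close> q2 power_inject_exp[of q n 1] by simp
    qed
    \<comment> \<open>The first length is the dimension of \<open>S\<close>, so the points at
      infinity have equal weight. The lengths are admissible because
      \<open>m + j \<le> t + 1\<close> and \<open>t * l + t \<le> n\<close>.\<close>
    define W where "W = power_span emb g (t * l + m) \<times> power_span emb g j"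
    have le: "t * l + m + j \<le> n + 1" "j \<le> n" "t * l + m \<le> n"
      using tl assms(18,19,20) by simp_all
    have "is_JVdV emb W"
      unfolding is_JVdV_def W_def using \<open>g \<notin> range emb\<close> geng le(1) assms(18,19)
      by (intro exI[of _ g] exI[of _ n] exI[of _ "t * l + m"] exI[of _ j]) simp
    moreover have "card (power_span emb g (t * l + m)) = card S"
      using F.card_power_span[OF geng le(3)] extended(2) q by simp
    moreover have "card {x. CARD('q) ^ i \<le> card (ratio_fibre (power_span emb g (t * l + m)) (power_span emb g j) x)} =
      card {x. CARD('q) ^ i \<le> card (ratio_fibre S T x)}" if i: "1 \<le> i" for i
    proof -
      have "(if i \<le> t * l + m \<and> i \<le> j then q ^ (t * l + m + j + 1 - 2 * i) else if i \<le> j then 1 else 0) =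
        q ^ (t * l) * (if i \<le> m \<and> i \<le> j then q ^ (m + j + 1 - 2 * i) else if i \<le> j then 1 else 0)"
      proof (cases "i \<le> j")
        case True
        have "i \<le> t * l + m" using True jm tl(1) assms(3) by linarith
        moreover have "t * l + m + j + 1 - 2 * i = t * l + (m + j + 1 - 2 * i)"
          using True jm by simp
        \<comment> \<open>This is where \<open>j \<le> m + 1\<close> matters: the only
          \<open>i\<close> with \<open>m < i \<le> j\<close> is \<open>i = j = m + 1\<close>. There
          the exponent vanishes, matching the default value 1 in the count for
          \<open>U\<close>.\<close>
        moreover have "m + j + 1 - 2 * i = 0" if "\<not> i \<le> m"
          using that True jm by simp
        ultimately show ?thesis
          using True by (cases "i \<le> m") (simp_all only: power_add simp_thms if_True if_False power_0)
      qed simp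
      then show ?thesis
        using F.card_ratio_fibre_ge[OF geng le(1,2) i] extended(3)[OF i] unfolding q by simp
    qed
    ultimately have "is_JVdV emb W \<and> weight_spectrum emb W = weight_spectrum emb U \<and>
                weight_distribution emb W = weight_distribution emb U"
      using F.weight_distribution_eqI[OF P P extended(1) T] unfolding W_def assms(23) by blast
    then show ?thesis by blast
  qed
  have not_exists: "weight_spectrum emb W \<noteq> weight_spectrum emb U" if JV: "is_JVdV emb W" and jm: "j > m + 1" for W
  proof
    assume eq: "weight_spectrum emb W = weight_spectrum emb U"
    obtain a s t1 t2 where W: "card (adjoin emb a) = CARD('q) ^ s" "1 \<le> t1" "1 \<le> t2" "t1 + t2 \<le> s + 1"
      "W = power_span emb a t1 \<times> power_span emb a t2"
      using JV unfolding is_JVdV_def by blast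
    have specW: "i \<in> weight_spectrum emb W \<longleftrightarrow> 1 \<le> i \<and> i \<le> min t1 t2 \<or> i = max t1 t2" for i
      unfolding W(5) by (rule F.mem_weight_spectrum_power_span_iff[OF W(1-4)])
    have inj: "q ^ u = q ^ v \<longleftrightarrow> u = v" for u v
      using power_inject_exp[of q] q2 by simp
    have specU: "i \<in> weight_spectrum emb U \<longleftrightarrow> 1 \<le> i \<and> (t * l + m = i \<or>
        card {x. q ^ i \<le> card (ratio_fibre S T x)} \<noteq> card {x. q ^ Suc i \<le> card (ratio_fibre S T x)})" for i
      using F.mem_weight_spectrum_iff[OF extended(1) T, of i] unfolding assms(23) extended(2) q inj .
    \<comment> \<open>The threshold count falls from \<open>q ^ (t * l)\<close> at \<open>j\<close>
      to 0 at \<open>j + 1\<close>.\<close>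
    have "j \<in> weight_spectrum emb U"
      unfolding specU using jm q2 assms(19) extended(3)[of j] extended(3)[of "Suc j"] by simp
    then have "1 \<le> j \<and> j \<le> min t1 t2 \<or> j = max t1 t2" unfolding eq[symmetric] specW .
    moreover have "t * l + m \<in> weight_spectrum emb U"
      unfolding specU using assms(18) by simp
    then have "t * l + m \<le> max t1 t2" unfolding eq[symmetric] specW by auto
    \<comment> \<open>As \<open>m + 2 \<le> j\<close>, the counts at \<open>m + 1\<close> and
      \<open>m + 2\<close> are both \<open>q ^ (t * l)\<close>; the point at infinity has weight
      \<open>t * l + m > m + 1\<close>.\<close>
    moreover have "m + 1 \<notin> weight_spectrum emb U"
      unfolding specU using jm extended(3)[of "m + 1"] extended(3)[of "Suc (m + 1)"] tl(1) assms(3) by simp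
    then have "\<not> m + 1 \<le> min t1 t2" unfolding eq[symmetric] specW by simp
    \<comment> \<open>Hence \<open>j\<close> is not the maximum of \<open>t1\<close> and
      \<open>t2\<close> and must lie in the initial segment, which would then contain
      \<open>m + 1\<close> as well.\<close>
    moreover have "j < t * l + m" using tl(1) assms(3,18,20) by linarith
    ultimately show False using jm by linarith
  qed
  show ?thesis
  proof (intro conjI impI iffI)
    assume "j \<le> m"
    then show "\<exists>W. is_JVdV emb W \<and> weight_spectrum emb W = weight_spectrum emb U \<and>
                weight_distribution emb W = weight_distribution emb U"
      by (intro exists) simp
  next
    assume "m < j" "\<exists>W. is_JVdV emb W \<and> weight_spectrum emb W = weight_spectrum emb U \<and>
                weight_distribution emb W = weight_distribution emb U"
    then show "j = m + 1" using not_exists by fastforce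
  next
    assume "j = m + 1"
    then show "\<exists>W. is_JVdV emb W \<and> weight_spectrum emb W = weight_spectrum emb U \<and>
                weight_distribution emb W = weight_distribution emb U"
      by (intro exists) simp
  qed
qed

end
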